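(* Let $k \geq 6$ be even, let $y \geq 1$ be odd, let $x$ be a positive integer with $x \neq 2$, and put $u = 4x$ and $g = ky$. Then there exists a $k$-ARCS of $(K_u \times K_g)(2)$.
   Context: For graphs $G,H$, the tensor product $G \times H$ has vertex set $V(G)\times V(H)$, with $(g_1,h_1)$ adjacent to $(g_2,h_2)$ iff $g_1g_2 \in E(G)$ and $h_1h_2 \in E(H)$. For a graph $G$ and positive integer $\lambda$, $G(\lambda)$ is the multigraph obtained by replacing each edge of $G$ by $\lambda$ parallel edges. $K_n$ is the complete graph on $n$ vertices. $(K_u \times K_g)(\lambda)$ is regarded as a $u$-partite multigraph with partite sets $V_i = \{i\}\times V(K_g)$, $i=1,\dots,u$. A partial $C_k$-factor of $(K_u \times K_g)(\lambda)$ is a subgraph which, for some $i$, is a spanning subgraph of $(K_u \times K_g)(\lambda)\setminus V_i$ all of whose components are cycles of length $k$. A $k$-ARCS of $(K_u \times K_g)(\lambda)$ is a partition of its edge multiset into partial $C_k$-factors. *)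

theory Defs
  imports Main "HOL-Library.Multiset"
begin

text \<open>Edges of graphs and multigraphs are unordered pairs, i.e. two-element sets of vertices;
  parallel edges of a multigraph are recorded by multiplicity.\<close>

record 'a graph =
  verts :: "'a set"
  edges :: "'a set set"

record 'a multigraph =
  mverts :: "'a set"
  medges :: "'a set multiset"

definition complete_graph :: "nat \<Rightarrow> nat graph" where
  "complete_graph n =
     \<lparr>verts = {1..n}, edges = {{a, b} | a b. a \<in> {1..n} \<and> b \<in> {1..n} \<and> a \<noteq> b}\<rparr>"

definition tensor_product :: "'a graph \<Rightarrow> 'b graph \<Rightarrow> ('a \<times> 'b) graph" where
  "tensor_product G H =
     \<lparr>verts = verts G \<times> verts H,
      edges = {{(g1, h1), (g2, h2)} | g1 h1 g2 h2. {g1, g2} \<in> edges G \<and> {h1, h2} \<in> edges H}\<rparr>"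

text \<open>The multigraph \<open>G(\<lambda>)\<close>. Since \<^const>\<open>mset_set\<close> of an infinite set is empty, this is only
  meaningful for graphs with finitely many edges.\<close>

definition multiply_edges :: "'a graph \<Rightarrow> nat \<Rightarrow> 'a multigraph" where
  "multiply_edges G l = \<lparr>mverts = verts G, medges = repeat_mset l (mset_set (edges G))\<rparr>"

definition subgraph :: "'a multigraph \<Rightarrow> 'a multigraph \<Rightarrow> bool" where
  "subgraph H G \<longleftrightarrow>
     mverts H \<subseteq> mverts G \<and> medges H \<subseteq># medges G \<and> (\<forall>e \<in># medges H. e \<subseteq> mverts H)"

definition spanning_subgraph :: "'a multigraph \<Rightarrow> 'a multigraph \<Rightarrow> bool" where
  "spanning_subgraph H G \<longleftrightarrow> subgraph H G \<and> mverts H = mverts G"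

definition delete_verts :: "'a multigraph \<Rightarrow> 'a set \<Rightarrow> 'a multigraph" where
  "delete_verts G W =
     \<lparr>mverts = mverts G - W, medges = filter_mset (\<lambda>e. e \<inter> W = {}) (medges G)\<rparr>"

definition induced_subgraph :: "'a multigraph \<Rightarrow> 'a set \<Rightarrow> 'a multigraph" where
  "induced_subgraph G W =
     \<lparr>mverts = mverts G \<inter> W, medges = filter_mset (\<lambda>e. e \<subseteq> W) (medges G)\<rparr>"

definition adjacent :: "'a multigraph \<Rightarrow> 'a \<Rightarrow> 'a \<Rightarrow> bool" where
  "adjacent G v w \<longleftrightarrow> {v, w} \<in># medges G"

definition components :: "'a multigraph \<Rightarrow> 'a multigraph set" where
  "components G = {induced_subgraph G {w. (adjacent G)\<^sup>*\<^sup>* v w} | v. v \<in> mverts G}"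

definition cycle_edges :: "'a list \<Rightarrow> 'a set multiset" where
  "cycle_edges vs = mset (map (\<lambda>i. {vs ! i, vs ! (Suc i mod length vs)}) [0..<length vs])"

definition is_cycle :: "nat \<Rightarrow> 'a multigraph \<Rightarrow> bool" where
  "is_cycle k C \<longleftrightarrow>
     (\<exists>vs. distinct vs \<and> length vs = k \<and> mverts C = set vs \<and> medges C = cycle_edges vs)"

definition complete_tensor :: "nat \<Rightarrow> nat \<Rightarrow> nat \<Rightarrow> (nat \<times> nat) multigraph" where
  "complete_tensor u g l = multiply_edges (tensor_product (complete_graph u) (complete_graph g)) l"

definition partite_set :: "nat \<Rightarrow> nat \<Rightarrow> (nat \<times> nat) set" where
  "partite_set g i = {i} \<times> verts (complete_graph g)"

definition partial_cycle_factor ::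
    "nat \<Rightarrow> nat \<Rightarrow> nat \<Rightarrow> nat \<Rightarrow> (nat \<times> nat) multigraph \<Rightarrow> bool" where
  "partial_cycle_factor k u g l F \<longleftrightarrow>
     (\<exists>i \<in> {1..u}. spanning_subgraph F (delete_verts (complete_tensor u g l) (partite_set g i))) \<and>
     (\<forall>C \<in> components F. is_cycle k C)"

text \<open>The factors form a multiset: because of parallel edges, two classes of the partition may be
  equal as multisets of vertex pairs.\<close>

definition is_ARCS ::
    "nat \<Rightarrow> nat \<Rightarrow> nat \<Rightarrow> nat \<Rightarrow> (nat \<times> nat) multigraph multiset \<Rightarrow> bool" where
  "is_ARCS k u g l P \<longleftrightarrow>
     (\<forall>F \<in># P. partial_cycle_factor k u g l F) \<and>
     (\<Sum>F \<in># P. medges F) = medges (complete_tensor u g l)"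

end

theory Submission
  imports Defs "HOL-Library.FuncSet"
begin

text \<open>
  An idempotent Latin square \<open>s\<close> of order \<open>u\<close> gives for each \<open>i\<close> a permutation \<open>s i\<close> of the parts
  fixing only \<open>i\<close>, and every ordered pair of distinct parts is \<open>(v, s i v)\<close> for exactly one \<open>i\<close>.
  Placing the vertices of an even cycle in \<open>K\<^sub>g\<close> alternately in the parts \<open>v\<close> and \<open>s i v\<close>, for all
  \<open>v \<noteq> i\<close>, turns a \<open>C\<^sub>k\<close>-factor of \<open>K\<^sub>g\<close> into a partial \<open>C\<^sub>k\<close>-factor missing the part \<open>i\<close>. Hence it
  suffices to find a \<open>C\<^sub>k\<close>-factorization of \<open>K\<^sub>g(2)\<close>.

  For \<open>g = k y\<close> with \<open>y\<close> odd, split the vertices into \<open>y\<close> levels of size \<open>k\<close>, indexed by \<open>\<int>\<^sub>y\<close>. Inside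
  the levels, use the rotations of a zigzag Hamiltonian cycle of \<open>K\<^sub>k(2)\<close>. The edges from level \<open>v\<close> to
  level \<open>v + d\<close>, for fixed \<open>1 \<le> d \<le> (y - 1) div 2\<close>, are treated together: in each factor one half of
  every level is joined upwards and the other half downwards, by a Hamiltonian cycle of
  \<open>K\<^sub>h\<^sub>,\<^sub>h\<close> with \<open>h = k div 2\<close>. Which half goes upwards is decided by one of the three nonzero linear
  forms on \<open>\<int>\<^sub>2\<^sup>2\<close>, chosen by a proper 3-colouring of the levels, so that the choices at adjacent levels
  are independent and all four pairs of halves occur equally often.
\<close>

section \<open>Cycle factorizations\<close>

text \<open>The one equation with \<open>mset_set V\<close> says, for finite \<open>V\<close>, that
  the lists have no repeated entries, are pairwise disjoint and cover \<open>V\<close>.\<close>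

definition cycle_factor :: "nat \<Rightarrow> 'a set \<Rightarrow> 'a set multiset \<Rightarrow> bool" where
  "cycle_factor k V E \<longleftrightarrow>
     (\<exists>M. (\<forall>vs \<in># M. length vs = k) \<and> (\<Sum>vs \<in># M. mset vs) = mset_set V \<and>
          (\<Sum>vs \<in># M. cycle_edges vs) = E)"

definition cycle_factorizable :: "nat \<Rightarrow> 'a set \<Rightarrow> 'a set multiset \<Rightarrow> bool" where
  "cycle_factorizable k V E \<longleftrightarrow> (\<exists>P. (\<forall>F \<in># P. cycle_factor k V F) \<and> \<Sum>\<^sub># P = E)"

definition offdiag :: "'a set \<Rightarrow> ('a \<times> 'a) set" where
  "offdiag V = {(a, b). a \<in> V \<and> b \<in> V \<and> a \<noteq> b}"

text \<open>Each unordered pair arises from its two orientations, so for finite \<open>V\<close>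
  this is the edge multiset of the complete graph on \<open>V\<close> with all edges
  doubled.\<close>

definition double_complete :: "'a set \<Rightarrow> 'a set multiset" where
  "double_complete V = (\<Sum>(a, b) \<in> offdiag V. {#{a, b}#})"

lemma finite_offdiag [simp]: "finite V \<Longrightarrow> finite (offdiag V)"
  by (rule finite_subset[of _ "V \<times> V"]) (auto simp: offdiag_def)

lemma mset_eq_sum_nth: "mset vs = (\<Sum>j<length vs. {#vs ! j#})"
  by (induction vs rule: rev_induct) (auto simp: nth_append)

lemma mset_map_upt_eq_sum: "mset (map f [0..<n]) = (\<Sum>j<n. {#f j#})"
  by (induction n) auto

lemma cycle_edges_eq_sum:
  "cycle_edges vs = (\<Sum>j<length vs. {#{vs ! j, vs ! (Suc j mod length vs)}#})"
  by (simp only: cycle_edges_def mset_map_upt_eq_sum)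

lemma sum_mset_mset_set_image:
  "(\<Sum>x \<in># image_mset c (mset_set I). f x) = (\<Sum>i\<in>I. f (c i))"
  by (simp add: sum_unfold_sum_mset image_mset.compositionality comp_def)

lemma cycle_factorI:
  assumes "\<And>i. i \<in> I \<Longrightarrow> length (c i) = k"
    and "(\<Sum>i\<in>I. mset (c i)) = mset_set V"
    and "(\<Sum>i\<in>I. cycle_edges (c i)) = E"
  shows "cycle_factor k V E"
  unfolding cycle_factor_def
proof (intro exI[of _ "image_mset c (mset_set I)"] conjI ballI)
  fix vs assume "vs \<in># image_mset c (mset_set I)"
  then show "length vs = k"
    using assms(1) by (cases "finite I") auto
qed (use assms(2,3) in \<open>simp_all only: sum_mset_mset_set_image\<close>)

lemma cycle_factorizable_single: "cycle_factor k V E \<Longrightarrow> cycle_factorizable k V E"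
  unfolding cycle_factorizable_def by (rule exI[of _ "{#E#}"]) auto

lemma cycle_factorizable_empty: "cycle_factorizable k V {#}"
  unfolding cycle_factorizable_def by (rule exI[of _ "{#}"]) auto

lemma cycle_factorizable_add:
  assumes "cycle_factorizable k V E" "cycle_factorizable k V E'"
  shows "cycle_factorizable k V (E + E')"
proof -
  obtain P P' where "\<forall>F \<in># P. cycle_factor k V F" "\<Sum>\<^sub># P = E"
    "\<forall>F \<in># P'. cycle_factor k V F" "\<Sum>\<^sub># P' = E'"
    using assms unfolding cycle_factorizable_def by blast
  then show ?thesis
    unfolding cycle_factorizable_def by (intro exI[of _ "P + P'"]) auto
qed

lemma cycle_factorizable_sum:
  assumes "\<And>i. i \<in> I \<Longrightarrow> cycle_factorizable k V (E i)"
  shows "cycle_factorizable k V (\<Sum>i\<in>I. E i)"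
  using assms
  by (induction I rule: infinite_finite_induct)
     (auto intro: cycle_factorizable_empty cycle_factorizable_add)

section \<open>Transport along injective maps\<close>

lemma cycle_edges_map: "cycle_edges (map f vs) = image_mset (image f) (cycle_edges vs)"
proof (cases "vs = []")
  case False
  then have "Suc j mod length vs < length vs" for j by simp
  then show ?thesis
    by (auto simp: cycle_edges_def image_mset.compositionality intro!: image_mset_cong)
qed (simp add: cycle_edges_def)

lemma image_mset_sum: "image_mset f (\<Sum>i\<in>I. g i) = (\<Sum>i\<in>I. image_mset f (g i))"
  by (induction I rule: infinite_finite_induct) auto

lemma image_mset_sum_mset: "image_mset f (\<Sum>x \<in># M. g x) = (\<Sum>x \<in># M. image_mset f (g x))"
  by (induction M) auto

lemma cycle_factor_image:
  assumes "cycle_factor k V E" "inj_on f V"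
  shows "cycle_factor k (f ` V) (image_mset (image f) E)"
proof -
  obtain M where M: "\<forall>vs \<in># M. length vs = k" "(\<Sum>vs \<in># M. mset vs) = mset_set V"
    "(\<Sum>vs \<in># M. cycle_edges vs) = E"
    using assms(1) unfolding cycle_factor_def by blast
  have "(\<Sum>vs \<in># image_mset (map f) M. mset vs) = image_mset f (mset_set V)"
    unfolding M(2)[symmetric]
    by (simp add: image_mset_sum_mset image_mset.compositionality comp_def)
  moreover have "(\<Sum>vs \<in># image_mset (map f) M. cycle_edges vs) = image_mset (image f) E"
    unfolding M(3)[symmetric]
    by (simp add: image_mset_sum_mset image_mset.compositionality comp_def cycle_edges_map)
  ultimately show ?thesis
    unfolding cycle_factor_def using M(1) assms(2)
    by (intro exI[of _ "image_mset (map f) M"]) (auto simp: image_mset_mset_set)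
qed

lemma cycle_factorizable_image:
  assumes "cycle_factorizable k V E" "inj_on f V"
  shows "cycle_factorizable k (f ` V) (image_mset (image f) E)"
proof -
  obtain P where P: "\<forall>F \<in># P. cycle_factor k V F" "\<Sum>\<^sub># P = E"
    using assms unfolding cycle_factorizable_def by blast
  have "\<Sum>\<^sub># (image_mset (image_mset (image f)) P) = image_mset (image f) E"
    unfolding P(2)[symmetric] using image_mset_sum_mset[of "image f" "\<lambda>x. x" P] by simp
  then show ?thesis
    unfolding cycle_factorizable_def using P(1) assms(2)
    by (intro exI[of _ "image_mset (image_mset (image f)) P"]) (auto intro: cycle_factor_image)
qed

lemma double_complete_image:
  assumes "inj_on f V"
  shows "double_complete (f ` V) = image_mset (image f) (double_complete V)"
proof -
  have "bij_betw (map_prod f f) (offdiag V) (offdiag (f ` V))"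
    using assms unfolding bij_betw_def
    by (auto simp: offdiag_def inj_on_def image_iff)
  from sum.reindex_bij_betw[OF this, of "\<lambda>(a, b). {#{a, b}#}"]
  show ?thesis
    by (simp add: double_complete_def image_mset_sum case_prod_unfold)
qed

text \<open>Only the cardinality matters, so each construction may choose a convenient model of the
  vertex set.\<close>

lemma cycle_factorizable_double_complete_transfer:
  assumes "cycle_factorizable k V (double_complete V)"
    and "finite V" "finite W" "card V = card W"
  shows "cycle_factorizable k W (double_complete W)"
proof -
  obtain f where f: "inj_on f V" "f ` V = W"
    using finite_same_card_bij[OF assms(2-4)] unfolding bij_betw_def by blast
  show ?thesis
    using cycle_factorizable_image[OF assms(1) f(1)] double_complete_image[OF f(1)] f(2) by simp
qed

section \<open>Hamiltonian cycles of the doubled complete graph\<close>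

lemma bij_betw_add_mod:
  fixes n c :: int
  assumes "n > 0"
  shows "bij_betw (\<lambda>a. (a + c) mod n) {0..<n} {0..<n}"
proof -
  have "inj_on (\<lambda>a. (a + c) mod n) {0..<n}"
  proof (rule inj_onI)
    fix a b assume *: "a \<in> {0..<n}" "b \<in> {0..<n}" "(a + c) mod n = (b + c) mod n"
    then have "a mod n = b mod n"
      by (metis add_diff_cancel_right' mod_diff_left_eq)
    then show "a = b" using * by simp
  qed
  moreover have "(\<lambda>a. (a + c) mod n) ` {0..<n} \<subseteq> {0..<n}" using assms by auto
  ultimately show ?thesis
    by (simp add: bij_betw_def endo_inj_surj)
qed

text \<open>Ordered pairs are sorted by their difference \<open>d = (b - a) mod n\<close>, which is
  nonzero exactly off the diagonal.\<close>

lemma sum_offdiag_int: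
  fixes n :: int and g :: "int \<Rightarrow> int \<Rightarrow> 'b::comm_monoid_add"
  assumes "n > 0"
  shows "(\<Sum>(a, b) \<in> offdiag {0..<n}. g a b) = (\<Sum>d\<in>{1..<n}. \<Sum>a\<in>{0..<n}. g a ((a + d) mod n))"
proof -
  have "bij_betw (\<lambda>(d, a). (a, (a + d) mod n)) ({1..<n} \<times> {0..<n}) (offdiag {0..<n})"
  proof (rule bij_betwI[where g = "\<lambda>(a, b). ((b - a) mod n, a)"])
    show "(\<lambda>(d, a). (a, (a + d) mod n)) \<in> {1..<n} \<times> {0..<n} \<rightarrow> offdiag {0..<n}"
    proof (clarsimp simp: offdiag_def assms)
      fix d a assume "1 \<le> d" "d < n" "0 \<le> a" "a < n" "a = (a + d) mod n"
      then have "((a + d) - a) mod n = 0"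
        by (metis diff_self mod_0 mod_diff_left_eq)
      then show False using \<open>1 \<le> d\<close> \<open>d < n\<close> by simp
    qed
    show "(\<lambda>(a, b). ((b - a) mod n, a)) \<in> offdiag {0..<n} \<rightarrow> {1..<n} \<times> {0..<n}"
    proof (clarsimp simp: offdiag_def assms)
      fix a b assume *: "0 \<le> a" "a < n" "0 \<le> b" "b < n" "a \<noteq> b"
      have "(b - a) mod n \<noteq> 0"
      proof
        assume "(b - a) mod n = 0"
        then have "b mod n = a mod n" by (simp add: mod_eq_dvd_iff mod_eq_0_iff_dvd)
        then show False using * by simp
      qed
      then show "1 \<le> (b - a) mod n" using assms pos_mod_sign[of n "b - a"] by linarith
    qed
  qed (auto simp: offdiag_def mod_simps)
  from sum.reindex_bij_betw[OF this, of "\<lambda>(a, b). g a b"]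
  show ?thesis by (simp add: sum.cartesian_product case_prod_unfold)
qed

text \<open>The sequence 0, 1, -1, 2, -2, ... of Walecki's construction; its successive steps have
  lengths 1, 2, 3, ... with alternating signs.\<close>

definition zigzag :: "nat \<Rightarrow> int" where
  "zigzag j = (if even j then - (int j div 2) else (int j + 1) div 2)"

lemma zigzag_Suc:
  "zigzag (Suc j) = (if even j then zigzag j + int (Suc j) else zigzag j - int (Suc j))"
  by (auto simp: zigzag_def elim!: evenE oddE)

lemma inj_zigzag: "inj zigzag"
  unfolding inj_def zigzag_def by (auto split: if_splits elim!: evenE oddE)

text \<open>The first \<open>2 * m + 1\<close> terms are the integers from \<open>-m\<close> to
  \<open>m\<close>, hence a complete residue system.\<close>

lemma bij_betw_zigzag_mod:
  fixes m :: nat and r :: int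
  defines "n \<equiv> 2 * m + 1"
  shows "bij_betw (\<lambda>j. (zigzag j + r) mod int n) {..<n} {0..<int n}"
proof -
  have bound: "zigzag j \<le> int m \<and> - int m \<le> zigzag j" if "j < n" for j
    using that unfolding zigzag_def n_def by (auto elim!: oddE)
  have "inj_on (\<lambda>j. (zigzag j + r) mod int n) {..<n}"
  proof (rule inj_onI)
    fix i j assume *: "i \<in> {..<n}" "j \<in> {..<n}"
      "(zigzag i + r) mod int n = (zigzag j + r) mod int n"
    then have "int n dvd zigzag i - zigzag j"
      by (simp add: mod_eq_dvd_iff)
    moreover have "\<bar>zigzag i - zigzag j\<bar> < int n"
      using bound[of i] bound[of j] * by (auto simp: n_def)
    ultimately have "zigzag i = zigzag j"
      using zdvd_imp_le[of "int n" "\<bar>zigzag i - zigzag j\<bar>"] by (cases "zigzag i = zigzag j") auto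
    then show "i = j" using inj_zigzag by (auto dest: injD)
  qed
  moreover have "(\<lambda>j. (zigzag j + r) mod int n) ` {..<n} \<subseteq> {0..<int n}"
    by (auto simp: n_def)
  ultimately show ?thesis
    unfolding bij_betw_def by (metis card_image card_subset_eq card_lessThan card_atLeastLessThan_int
        diff_zero finite_atLeastLessThan_int nat_int)
qed

text \<open>The zigzag path through the residues modulo \<open>n = k - 1\<close> is closed through
  an extra fixed point \<open>None\<close> and rotated in all \<open>n\<close> ways. The
  \<open>j\<close>-th path edge sweeps out the difference \<open>j + 1\<close>, so every nonzero
  difference occurs once; each of the two edges at \<open>None\<close> sweeps out all edges
  there.\<close>

lemma cycle_factorizable_double_complete:
  assumes "finite W" "card W = k" "even k" "k \<ge> 2"
  shows "cycle_factorizable k W (double_complete W)"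
proof -
  define m where "m = (k - 2) div 2"
  define n where "n = 2 * m + 1"
  have k: "k = Suc n" using assms(3,4) unfolding n_def m_def by (auto elim!: evenE)
  define N where "N = {0..<int n}"
  define V where "V = insert None (Some ` N)"
  define p where "p r j = Some ((zigzag j + r) mod int n)" for r j
  define c where "c r = None # map (p r) [0..<n]" for r
  have len: "length (c r) = k" for r by (simp add: c_def k)
  have n0: "int n > 0" by (simp add: n_def)
  have mset_c: "mset (c r) = mset_set V" for r
  proof -
    have "(\<Sum>j<n. {#p r j#}) = (\<Sum>a\<in>N. {#Some a#})"
      unfolding p_def N_def
      using sum.reindex_bij_betw[OF bij_betw_zigzag_mod[where m = m and r = r], of "\<lambda>a. {#Some a#}"]
      by (simp add: n_def)
    then have "mset (c r) = {#None#} + (\<Sum>a\<in>N. {#Some a#})"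
      unfolding c_def mset.simps mset_map_upt_eq_sum by simp
    also have "\<dots> = mset_set V"
      unfolding V_def sum_multiset_singleton[symmetric]
      by (simp add: N_def sum.reindex del: sum_multiset_singleton)
    finally show ?thesis .
  qed
  have edges_c: "cycle_edges (c r) =
      {#{None, p r 0}#} + (\<Sum>j<2*m. {#{p r j, p r (Suc j)}#}) + {#{p r (2*m), None}#}" for r
  proof -
    have nth: "c r ! Suc j = p r j" if "j \<le> 2*m" for j
      using that by (simp add: c_def n_def del: upt_Suc)
    have "cycle_edges (c r) = (\<Sum>j<Suc n. {#{c r ! j, c r ! (Suc j mod Suc n)}#})"
      by (simp add: cycle_edges_eq_sum c_def)
    also have "\<dots> = {#{c r ! 0, c r ! 1}#}
        + (\<Sum>j<n. {#{c r ! Suc j, c r ! (Suc (Suc j) mod Suc n)}#})"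
      by (subst sum.lessThan_Suc_shift) (simp add: n_def)
    also have "(\<Sum>j<n. {#{c r ! Suc j, c r ! (Suc (Suc j) mod Suc n)}#}) =
        (\<Sum>j<2*m. {#{c r ! Suc j, c r ! Suc (Suc j)}#}) + {#{c r ! Suc (2*m), None}#}"
      by (simp add: n_def c_def)
    moreover have "c r ! 0 = None" by (simp add: c_def)
    ultimately show ?thesis using nth[of 0] by (simp add: nth)
  qed
  have shift: "(\<Sum>r\<in>N. f ((z + r) mod int n)) = (\<Sum>a\<in>N. f a)"
    for z and f :: "int \<Rightarrow> int option set multiset"
    unfolding N_def using sum.reindex_bij_betw[OF bij_betw_add_mod[OF n0, of z], of f]
    by (simp add: add.commute)
  \<comment> \<open>For even \<open>j\<close> the path goes up by \<open>j + 1\<close>; for odd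
    \<open>j\<close> it goes down by \<open>j + 1\<close>, and the edge is read backwards.\<close>
  have mid: "(\<Sum>r\<in>N. {#{p r j, p r (Suc j)}#}) =
      (\<Sum>a\<in>N. {#{Some a, Some ((a + int (Suc j)) mod int n)}#})" for j
  proof (cases "even j")
    case True
    have "p r (Suc j) = Some ((((zigzag j + r) mod int n) + int (Suc j)) mod int n)" for r
      using True unfolding p_def mod_add_left_eq zigzag_Suc by (simp add: algebra_simps)
    then show ?thesis
      using shift[of "\<lambda>a. {#{Some a, Some ((a + int (Suc j)) mod int n)}#}" "zigzag j"]
      by (simp add: p_def)
  next
    case False
    have "p r j = Some ((((zigzag (Suc j) + r) mod int n) + int (Suc j)) mod int n)" for r
      using False unfolding p_def mod_add_left_eq zigzag_Suc by (simp add: algebra_simps)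
    then show ?thesis
      using shift[of "\<lambda>a. {#{Some a, Some ((a + int (Suc j)) mod int n)}#}" "zigzag (Suc j)"]
      by (simp add: p_def insert_commute)
  qed
  have "(\<Sum>r\<in>N. cycle_edges (c r)) = (\<Sum>a\<in>N. {#{None, Some a}#})
      + (\<Sum>j<2*m. \<Sum>a\<in>N. {#{Some a, Some ((a + int (Suc j)) mod int n)}#})
      + (\<Sum>a\<in>N. {#{Some a, None}#})"
    unfolding edges_c sum.distrib mid[symmetric]
    using shift[of "\<lambda>a. {#{None, Some a}#}" "zigzag 0"]
      shift[of "\<lambda>a. {#{Some a, None}#}" "zigzag (2*m)"]
      sum.swap[of "\<lambda>r j. {#{p r j, p r (Suc j)}#}" "{..<2*m}" N]
    by (simp add: p_def)
  \<comment> \<open>\<open>d = j + 1\<close> runs through all nonzero residues modulo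
    \<open>n\<close>.\<close>
  also have "(\<Sum>j<2*m. \<Sum>a\<in>N. {#{Some a, Some ((a + int (Suc j)) mod int n)}#}) =
     (\<Sum>d\<in>{1..<int n}. \<Sum>a\<in>N. {#{Some a, Some ((a + d) mod int n)}#})"
    by (rule sum.reindex_bij_witness[where i = "\<lambda>d. nat d - 1" and j = "\<lambda>j. int (Suc j)"])
       (auto simp: n_def)
  also have "\<dots> = (\<Sum>(a, b)\<in>offdiag N. {#{Some a, Some b}#})"
    unfolding N_def by (rule sum_offdiag_int[OF n0, symmetric])
  also have "(\<Sum>a\<in>N. {#{None, Some a}#}) + \<dots> + (\<Sum>a\<in>N. {#{Some a, None}#}) = double_complete V"
  proof -
    have dec: "offdiag V = (\<lambda>a. (None, Some a)) ` N \<union> map_prod Some Some ` offdiag N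
        \<union> (\<lambda>a. (Some a, None)) ` N"
      by (auto simp: V_def offdiag_def)
    have fin: "finite N" by (simp add: N_def)
    have inj: "inj_on (map_prod Some Some) (offdiag N)" by (auto simp: inj_on_def)
    show ?thesis
      unfolding double_complete_def dec
      using fin
      apply (subst sum.union_disjoint, simp, simp, force)
      apply (subst sum.union_disjoint, simp, simp, force)
      apply (simp add: sum.reindex[OF inj] sum.reindex inj_on_def case_prod_unfold)
      done
  qed
  finally have sumc: "(\<Sum>r\<in>N. cycle_edges (c r)) = double_complete V" .
  have "cycle_factorizable k V (\<Sum>r\<in>N. cycle_edges (c r))"
  proof (intro cycle_factorizable_sum cycle_factorizable_single)
    fix r
    show "cycle_factor k V (cycle_edges (c r))"
      by (rule cycle_factorI[where I = "{()}" and c = "\<lambda>_. c r"]) (simp_all add: len mset_c)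
  qed
  then have "cycle_factorizable k V (double_complete V)" by (simp add: sumc)
  then show ?thesis
    by (rule cycle_factorizable_double_complete_transfer)
       (use assms k in \<open>simp_all add: V_def N_def card_image\<close>)
qed

section \<open>Factors between levels\<close>

definition alternate :: "'a \<Rightarrow> 'a \<Rightarrow> 'b list \<Rightarrow> ('a \<times> 'b) list" where
  "alternate v w vs = map (\<lambda>j. (if even j then v else w, vs ! j)) [0..<length vs]"

lemma length_alternate [simp]: "length (alternate v w vs) = length vs"
  by (simp add: alternate_def)

lemma alternate_same: "alternate v v vs = map (Pair v) vs"
  by (rule nth_equalityI) (auto simp: alternate_def)

text \<open>The even length makes the closing edge, too, join \<open>v\<close> to \<open>w\<close>.
  The end in \<open>v\<close> is written first at all positions, because later sums run over ordered
  pairs of parts.\<close>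

lemma cycle_edges_alternate:
  assumes "even (length vs)"
  shows "cycle_edges (alternate v w vs) =
    (\<Sum>j<length vs. if even j then {#{(v, vs ! j), (w, vs ! (Suc j mod length vs))}#}
                     else {#{(v, vs ! (Suc j mod length vs)), (w, vs ! j)}#})"
  unfolding cycle_edges_eq_sum length_alternate
proof (rule sum.cong[OF refl])
  fix j assume j: "j \<in> {..<length vs}"
  then have "Suc j mod length vs < length vs"
    by (metis gr_implies_not0 lessThan_iff mod_less_divisor neq0_conv)
  moreover have "even (Suc j mod length vs) \<longleftrightarrow> odd j"
    using assms by (simp add: dvd_mod_iff)
  ultimately show "{#{alternate v w vs ! j, alternate v w vs ! (Suc j mod length vs)}#} =
      (if even j then {#{(v, vs ! j), (w, vs ! (Suc j mod length vs))}#}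
       else {#{(v, vs ! (Suc j mod length vs)), (w, vs ! j)}#})"
    using j by (simp add: alternate_def insert_commute)
qed

lemma sum_mset_sum: "(\<Sum>x \<in># M. \<Sum>i\<in>I. f x i) = (\<Sum>i\<in>I. \<Sum>x \<in># M. f x i)"
  by (induction M) (auto simp: sum.distrib)

text \<open>At a fixed position of a list the first coordinate is \<open>v\<close> or
  \<open>\<sigma> v\<close>, and either runs once through \<open>V\<close> as \<open>v\<close> does.
  The identity will give copies of a factor, the rows of an idempotent square factors between
  different parts.\<close>

lemma cycle_factor_alternate:
  fixes V :: "'a set" and C :: "'b set"
  assumes M: "\<forall>vs \<in># M. length vs = k" "(\<Sum>vs \<in># M. mset vs) = mset_set C"
    and \<sigma>: "bij_betw \<sigma> V V" and fin: "finite V" "finite C"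
  shows "cycle_factor k (V \<times> C) (\<Sum>vs \<in># M. \<Sum>v\<in>V. cycle_edges (alternate v (\<sigma> v) vs))"
proof -
  define N where "N = (\<Sum>vs \<in># M. image_mset (\<lambda>v. alternate v (\<sigma> v) vs) (mset_set V))"
  have sum_N: "(\<Sum>vs \<in># N. f vs) = (\<Sum>vs \<in># M. \<Sum>v\<in>V. f (alternate v (\<sigma> v) vs))"
    for f :: "_ \<Rightarrow> 'x::comm_monoid_add"
    unfolding N_def by (induction M) (simp_all add: sum_mset_mset_set_image)
  have col: "(\<Sum>v\<in>V. mset (alternate v (\<sigma> v) vs)) = (\<Sum>v\<in>V. image_mset (Pair v) (mset vs))"
    for vs :: "'b list"
  proof -
    have "(\<Sum>v\<in>V. {#(if even j then v else \<sigma> v, x)#}) = (\<Sum>v\<in>V. {#(v, x)#})" for j :: nat and x :: 'b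
      using sum.reindex_bij_betw[OF \<sigma>, of "\<lambda>v. {#(v, x)#}"] by (cases "even j") auto
    then have "(\<Sum>v\<in>V. mset (alternate v (\<sigma> v) vs)) = (\<Sum>v\<in>V. \<Sum>j<length vs. {#(v, vs ! j)#})"
      unfolding alternate_def mset_map_upt_eq_sum by (subst (1 2) sum.swap) simp
    also have "\<dots> = (\<Sum>v\<in>V. image_mset (Pair v) (mset vs))"
      by (simp only: mset_eq_sum_nth image_mset_sum image_mset_single)
    finally show ?thesis .
  qed
  have "(\<Sum>vs \<in># N. mset vs) = (\<Sum>v\<in>V. image_mset (Pair v) (mset_set C))"
    unfolding sum_N col sum_mset_sum M(2)[symmetric] image_mset_sum_mset ..
  also have "\<dots> = mset_set (V \<times> C)"
    using fin by (simp add: sum_multiset_singleton[symmetric] image_mset_sum sum.cartesian_product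
        case_prod_unfold del: sum_multiset_singleton)
  finally have "(\<Sum>vs \<in># N. mset vs) = mset_set (V \<times> C)" .
  moreover have "\<forall>vs \<in># N. length vs = k"
    using M(1) fin(1) unfolding N_def by (induction M) auto
  ultimately show ?thesis
    unfolding cycle_factor_def by (intro exI[of _ N]) (simp add: sum_N)
qed

lemma cycle_factorizable_copies:
  assumes "cycle_factorizable k C E" and fin: "finite V" "finite C"
  shows "cycle_factorizable k (V \<times> C) (\<Sum>v\<in>V. image_mset (image (Pair v)) E)"
proof -
  obtain P where P: "\<forall>F \<in># P. cycle_factor k C F" "\<Sum>\<^sub># P = E"
    using assms(1) unfolding cycle_factorizable_def by blast
  have "cycle_factor k (V \<times> C) (\<Sum>v\<in>V. image_mset (image (Pair v)) F)" if "F \<in># P" for F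
  proof -
    have "cycle_factor k C F" using P(1) that by blast
    then obtain M where M: "\<forall>vs \<in># M. length vs = k" "(\<Sum>vs \<in># M. mset vs) = mset_set C"
      "(\<Sum>vs \<in># M. cycle_edges vs) = F"
      unfolding cycle_factor_def by blast
    show ?thesis
      using cycle_factor_alternate[OF M(1,2), of "\<lambda>v. v" V] fin
      unfolding M(3)[symmetric]
      by (simp add: alternate_same cycle_edges_map sum_mset_sum image_mset_sum_mset bij_betw_def)
  qed
  moreover have "(\<Sum>F\<in>#P. \<Sum>v\<in>V. image_mset (image (Pair v)) F) = (\<Sum>v\<in>V. image_mset (image (Pair v)) E)"
    unfolding P(2)[symmetric] sum_mset_sum
    by (simp add: image_mset_sum_mset[of _ "\<lambda>x. x", simplified])
  ultimately show ?thesis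
    unfolding cycle_factorizable_def
    by (intro exI[of _ "image_mset (\<lambda>F. \<Sum>v\<in>V. image_mset (image (Pair v)) F) P"]) auto
qed

text \<open>Joining \<open>v\<close> to \<open>\<sigma> v\<close> gives a graph of degree at most
  two, as \<open>\<sigma>\<close> is injective, so greedy colouring succeeds with three colours. Odd
  cycles of \<open>\<sigma>\<close> rule out two.\<close>

lemma three_colouring:
  assumes "finite S" "S \<subseteq> V" and \<sigma>: "inj_on \<sigma> V" "\<And>v. v \<in> V \<Longrightarrow> \<sigma> v \<noteq> v"
  shows "\<exists>c. (\<forall>v. c v < (3::nat)) \<and> (\<forall>v\<in>S. \<sigma> v \<in> S \<longrightarrow> c v \<noteq> c (\<sigma> v))"
  using assms(1,2)
proof (induction S)
  case empty
  show ?case by (rule exI[of _ "\<lambda>_. 0"]) simp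
next
  case (insert w S)
  then obtain c where c: "\<forall>v. c v < (3::nat)" "\<forall>v\<in>S. \<sigma> v \<in> S \<longrightarrow> c v \<noteq> c (\<sigma> v)" by blast
  \<comment> \<open>The only possible predecessor of \<open>w\<close>; if there is none,
    \<open>u\<close> is arbitrary and avoiding its colour does no harm.\<close>
  define u where "u = inv_into V \<sigma> w"
  have u: "v = u" if "\<sigma> v = w" "v \<in> V" for v using that \<sigma>(1) by (auto simp: u_def)
  have "\<exists>x<3. x \<noteq> c u \<and> x \<noteq> c (\<sigma> w)" by presburger
  then obtain x where x: "x < 3" "x \<noteq> c u" "x \<noteq> c (\<sigma> w)" by blast
  have "(c(w := x)) v \<noteq> (c(w := x)) (\<sigma> v)" if "v \<in> insert w S" "\<sigma> v \<in> insert w S" for v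
  proof (cases "v = w")
    case True
    then show ?thesis using x(3) \<sigma>(2)[of w] insert.prems by auto
  next
    case False
    then show ?thesis
      using that c(2) x(2) u[of v] insert.prems by (cases "\<sigma> v = w") auto
  qed
  then show ?case
    using c(1) x(1) by (intro exI[of _ "c(w := x)"]) auto
qed

text \<open>The three nonzero linear forms on \<open>\<int>\<^sub>2\<^sup>2\<close>; any two of them are independent.\<close>

definition form :: "nat \<Rightarrow> bool \<times> bool \<Rightarrow> bool" where
  "form c s = (if c = 0 then fst s else if c = 1 then snd s else fst s \<noteq> snd s)"

text \<open>Two distinct nonzero forms together are a bijection of
  \<open>\<int>\<^sub>2\<^sup>2\<close> onto the pairs of values, and negating one value keeps it a
  bijection.\<close>

lemma sum_forms:
  assumes "a < 3" "b < 3" "a \<noteq> b"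
  shows "(\<Sum>s\<in>UNIV. f (form a s) (\<not> form b s)) = (\<Sum>x\<in>UNIV. \<Sum>y\<in>UNIV. f x y)"
proof -
  have "a = 0 \<or> a = 1 \<or> a = 2" "b = 0 \<or> b = 1 \<or> b = 2" using assms by auto
  moreover have univ: "(UNIV :: (bool \<times> bool) set) =
      {(False, False), (False, True), (True, False), (True, True)}"
    by auto
  ultimately show ?thesis
    using assms(3) unfolding univ by (elim disjE) (simp_all add: form_def UNIV_bool ac_simps)
qed

lemma sum_lessThan_double: "(\<Sum>j<2*h. f j) = (\<Sum>i<h. f (2*i) + f (2*i+1))" for h :: nat
  by (induction h) (simp_all add: ac_simps)

lemma sum_lessThan_int: "(\<Sum>i<h. f (int i)) = (\<Sum>i\<in>{0..<int h}. f i)"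
  by (rule sum.reindex_bij_witness[where i = nat and j = int]) auto

text \<open>Each choice of \<open>s\<close> and \<open>t\<close> gives one factor, with a cycle for
  every \<open>v\<close> between the \<open>up\<close> half of \<open>v\<close> and the
  \<open>down\<close> half of \<open>\<sigma> v\<close>. Varying \<open>t\<close> covers all edges
  between these halves twice, and varying \<open>s\<close> covers the four pairs of halves, whence
  \<open>X + X\<close>.\<close>

lemma cycle_factorizable_shift:
  fixes h :: nat and V :: "'a set" and \<sigma> :: "'a \<Rightarrow> 'a"
  defines "C \<equiv> (UNIV :: bool set) \<times> {0..<int h}"
  defines "X \<equiv> \<Sum>v\<in>V. \<Sum>p\<in>C. \<Sum>q\<in>C. {#{(v, p), (\<sigma> v, q)}#}"
  assumes fin: "finite V" and \<sigma>: "bij_betw \<sigma> V V" "\<And>v. v \<in> V \<Longrightarrow> \<sigma> v \<noteq> v" and h: "h > 0"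
  shows "cycle_factorizable (2 * h) (V \<times> C) (X + X)"
proof -
  define H where "H = {0..<int h}"
  have h0: "int h > 0" using h by simp
  obtain c where c: "\<And>v. c v < (3::nat)" "\<And>v. v \<in> V \<Longrightarrow> c v \<noteq> c (\<sigma> v)"
    using three_colouring[OF fin subset_refl, of \<sigma>] \<sigma> bij_betwE[OF \<sigma>(1)]
    by (metis bij_betw_imp_inj_on)
  define up where "up s v i = (v, form (c v) s, i)" for s v and i :: int
  define down where "down s v i = (v, \<not> form (c v) s, i)" for s v and i :: int
  define cyc where "cyc s t v = map (\<lambda>j. if even j then up s v (int (j div 2))
      else down s (\<sigma> v) ((int (j div 2) + t) mod int h)) [0..<2*h]" for s t v
  have shift: "(\<Sum>i\<in>H. f ((i + t) mod int h)) = (\<Sum>i\<in>H. f i)" for t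
    and f :: "int \<Rightarrow> 'x::comm_monoid_add"
    unfolding H_def by (rule sum.reindex_bij_betw[OF bij_betw_add_mod[OF h0]])
  \<comment> \<open>Level \<open>v\<close> meets two cycles: its own in the \<open>up\<close> half,
    and that of its preimage under \<open>\<sigma>\<close> in the complementary \<open>down\<close>
    half.\<close>
  have mset_cyc: "(\<Sum>v\<in>V. mset (cyc s t v)) = mset_set (V \<times> C)" for s t
  proof -
    have "mset (cyc s t v) = (\<Sum>i\<in>H. {#up s v i#}) + (\<Sum>i\<in>H. {#down s (\<sigma> v) i#})" for v
      unfolding cyc_def mset_map_upt_eq_sum sum_lessThan_double sum.distrib
      using shift[of "\<lambda>i. {#down s (\<sigma> v) i#}" t]
      by (simp add: H_def sum_lessThan_int[symmetric])
    then have "(\<Sum>v\<in>V. mset (cyc s t v)) =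
        (\<Sum>v\<in>V. \<Sum>i\<in>H. {#up s v i#}) + (\<Sum>v\<in>V. \<Sum>i\<in>H. {#down s v i#})"
      using sum.reindex_bij_betw[OF \<sigma>(1), of "\<lambda>v. \<Sum>i\<in>H. {#down s v i#}"]
      by (simp add: sum.distrib)
    also have "\<dots> = (\<Sum>v\<in>V. \<Sum>b\<in>UNIV. \<Sum>i\<in>H. {#(v, b, i)#})"
    proof (subst sum.distrib[symmetric], rule sum.cong[OF refl])
      show "(\<Sum>i\<in>H. {#up s v i#}) + (\<Sum>i\<in>H. {#down s v i#}) =
          (\<Sum>b\<in>UNIV. \<Sum>i\<in>H. {#(v, b, i)#})" for v
        by (cases "form (c v) s") (simp_all add: up_def down_def UNIV_bool add.commute)
    qed
    also have "\<dots> = mset_set (V \<times> C)"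
      by (simp add: sum_multiset_singleton[symmetric] sum.cartesian_product C_def H_def
          case_prod_unfold del: sum_multiset_singleton)
    finally show ?thesis .
  qed
  \<comment> \<open>On the cycle, \<open>up\<close> index \<open>i\<close> is followed by
    \<open>down\<close> index \<open>i + t\<close> and preceded by \<open>i - 1 + t\<close>, so the
    two edge families have differences \<open>t\<close> and \<open>t - 1\<close>.\<close>
  have edges_cyc: "cycle_edges (cyc s t v) =
      (\<Sum>i\<in>H. {#{up s v i, down s (\<sigma> v) ((i + t) mod int h)}#}) +
      (\<Sum>i\<in>H. {#{up s v i, down s (\<sigma> v) ((i + (t - 1)) mod int h)}#})" for s t v
  proof -
    have *: "Suc (Suc (2*i)) mod (2*h) = 2 * (Suc i mod h)" for i
      using mult_mod_right[of 2 "Suc i" h] by simp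
    have **: "Suc i mod h < h" for i using h by simp
    have "cycle_edges (cyc s t v) = (\<Sum>i<h. {#{up s v (int i), down s (\<sigma> v) ((int i + t) mod int h)}#}
       + {#{down s (\<sigma> v) ((int i + t) mod int h), up s v (int (Suc i mod h))}#})"
      unfolding cycle_edges_eq_sum
      unfolding cyc_def length_map length_upt minus_nat.diff_0 sum_lessThan_double
      by (rule sum.cong[OF refl]) (use ** in \<open>simp add: *\<close>)
    also have "\<dots> = (\<Sum>i\<in>H. {#{up s v i, down s (\<sigma> v) ((i + t) mod int h)}#}) +
      (\<Sum>i\<in>H. {#{up s v ((i + 1) mod int h),
         down s (\<sigma> v) (((i + 1) mod int h + (t - 1)) mod int h)}#})"
      unfolding H_def sum_lessThan_int[symmetric] sum.distrib
      by (simp add: mod_simps insert_commute zmod_int add.commute)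
    finally show ?thesis
      using shift[of "\<lambda>i. {#{up s v i, down s (\<sigma> v) ((i + (t - 1)) mod int h)}#}" 1] by simp
  qed
  \<comment> \<open>Used with \<open>d = 0\<close> and \<open>d = 1\<close>, once for each edge
    family; for fixed \<open>i\<close>, varying \<open>t\<close> reaches every index once.\<close>
  have part: "(\<Sum>s\<in>UNIV. \<Sum>t\<in>H. \<Sum>i\<in>H. {#{up s v i, down s (\<sigma> v) ((i + (t - d)) mod int h)}#}) =
      (\<Sum>p\<in>C. \<Sum>q\<in>C. {#{(v, p), (\<sigma> v, q)}#})" if "v \<in> V" for v d
  proof -
    have "(\<Sum>s\<in>UNIV. \<Sum>t\<in>H. \<Sum>i\<in>H. {#{up s v i, down s (\<sigma> v) ((i + (t - d)) mod int h)}#}) =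
        (\<Sum>s\<in>UNIV. \<Sum>i\<in>H. \<Sum>t\<in>H. {#{up s v i, down s (\<sigma> v) ((t + (i - d)) mod int h)}#})"
      by (subst sum.swap[of _ H H]) (simp add: algebra_simps)
    also have "\<dots> = (\<Sum>s\<in>UNIV. \<Sum>i\<in>H. \<Sum>j\<in>H. {#{up s v i, down s (\<sigma> v) j}#})"
      using shift[of "\<lambda>j. {#{up s v i, down s (\<sigma> v) j}#}" for s i] by simp
    also have "\<dots> = (\<Sum>x\<in>UNIV. \<Sum>y\<in>UNIV. \<Sum>i\<in>H. \<Sum>j\<in>H. {#{(v, x, i), (\<sigma> v, y, j)}#})"
      unfolding up_def down_def by (rule sum_forms) (use c that in auto)
    also have "\<dots> = (\<Sum>x\<in>UNIV. \<Sum>i\<in>H. \<Sum>y\<in>UNIV. \<Sum>j\<in>H. {#{(v, x, i), (\<sigma> v, y, j)}#})"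
      by (subst sum.swap[of _ H UNIV]) simp
    also have "\<dots> = (\<Sum>p\<in>C. \<Sum>q\<in>C. {#{(v, p), (\<sigma> v, q)}#})"
      by (simp only: C_def H_def sum.cartesian_product')
    finally show ?thesis .
  qed
  have "(\<Sum>s\<in>UNIV. \<Sum>t\<in>H. \<Sum>v\<in>V. cycle_edges (cyc s t v)) =
      (\<Sum>s\<in>UNIV. \<Sum>v\<in>V. \<Sum>t\<in>H. cycle_edges (cyc s t v))"
    by (intro sum.cong[OF refl] sum.swap)
  also have "\<dots> = (\<Sum>v\<in>V. \<Sum>s\<in>UNIV. \<Sum>t\<in>H. cycle_edges (cyc s t v))"
    by (rule sum.swap)
  also have "\<dots> = X + X"
    unfolding X_def edges_cyc
  proof (subst sum.distrib[symmetric], rule sum.cong[OF refl])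
    fix v assume "v \<in> V"
    then show "(\<Sum>s\<in>UNIV. \<Sum>t\<in>H. (\<Sum>i\<in>H. {#{up s v i, down s (\<sigma> v) ((i + t) mod int h)}#}) +
      (\<Sum>i\<in>H. {#{up s v i, down s (\<sigma> v) ((i + (t - 1)) mod int h)}#})) =
      (\<Sum>p\<in>C. \<Sum>q\<in>C. {#{(v, p), (\<sigma> v, q)}#}) + (\<Sum>p\<in>C. \<Sum>q\<in>C. {#{(v, p), (\<sigma> v, q)}#})"
      using part[of v 0] part[of v 1] unfolding sum.distrib by simp
  qed
  finally have total: "(\<Sum>s\<in>UNIV. \<Sum>t\<in>H. \<Sum>v\<in>V. cycle_edges (cyc s t v)) = X + X" .
  show ?thesis
    unfolding total[symmetric]
    by (intro cycle_factorizable_sum cycle_factorizable_single cycle_factorI[where I = V])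
       (simp_all add: mset_cyc, simp add: cyc_def)
qed

section \<open>Decomposing the doubled complete graph on \<open>k * y\<close> vertices\<close>

lemma double_complete_Times:
  assumes fin: "finite V" "finite C"
  shows "double_complete (V \<times> C) = (\<Sum>v\<in>V. image_mset (image (Pair v)) (double_complete C)) +
    (\<Sum>(v, w) \<in> offdiag V. \<Sum>p\<in>C. \<Sum>q\<in>C. {#{(v, p), (w, q)}#})"
proof -
  define f where "f = (\<lambda>(v :: 'a, p, q). ((v, p :: 'b), (v, q :: 'b)))"
  define g where "g = (\<lambda>((v :: 'a, w :: 'a), p, q). ((v, p :: 'b), (w, q :: 'b)))"
  have dec: "offdiag (V \<times> C) = f ` (V \<times> offdiag C) \<union> g ` (offdiag V \<times> (C \<times> C))"
    by (force simp: offdiag_def f_def g_def image_iff)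
  have disj: "f ` (V \<times> offdiag C) \<inter> g ` (offdiag V \<times> (C \<times> C)) = {}"
    by (auto simp: offdiag_def f_def g_def)
  have inj: "inj_on f (V \<times> offdiag C)" "inj_on g (offdiag V \<times> (C \<times> C))"
    by (auto simp: inj_on_def f_def g_def)
  have "double_complete (V \<times> C) = (\<Sum>(a, b) \<in> f ` (V \<times> offdiag C). {#{a, b}#}) +
      (\<Sum>(a, b) \<in> g ` (offdiag V \<times> (C \<times> C)). {#{a, b}#})"
    unfolding double_complete_def dec by (rule sum.union_disjoint) (use fin disj in auto)
  also have "(\<Sum>(a, b) \<in> f ` (V \<times> offdiag C). {#{a, b}#}) =
      (\<Sum>v\<in>V. \<Sum>(p, q)\<in>offdiag C. {#{(v, p), (v, q)}#})"
    unfolding sum.reindex[OF inj(1)] sum.cartesian_product'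
    by (simp add: f_def case_prod_unfold)
  also have "\<dots> = (\<Sum>v\<in>V. image_mset (image (Pair v)) (double_complete C))"
    by (simp add: double_complete_def image_mset_sum case_prod_unfold)
  also have "(\<Sum>(a, b) \<in> g ` (offdiag V \<times> (C \<times> C)). {#{a, b}#}) =
      (\<Sum>(v, w) \<in> offdiag V. \<Sum>p\<in>C. \<Sum>q\<in>C. {#{(v, p), (w, q)}#})"
    unfolding sum.reindex[OF inj(2)] sum.cartesian_product'
    by (simp add: g_def case_prod_unfold)
  finally show ?thesis .
qed

text \<open>The differences \<open>d\<close> and \<open>n - d\<close> give the same unordered pairs
  and, \<open>n\<close> being odd, never coincide, so the nonzero differences form \<open>m\<close>
  couples. Each couple has the shape \<open>X + X\<close> treated in
  \<open>cycle_factorizable_shift\<close>.\<close>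

lemma sum_offdiag_int_odd:
  fixes m :: nat and G :: "int \<Rightarrow> int \<Rightarrow> 'b::comm_monoid_add"
  defines "n \<equiv> 2 * int m + 1"
  assumes sym: "\<And>a b. G a b = G b a"
  shows "(\<Sum>(a, b) \<in> offdiag {0..<n}. G a b) =
    (\<Sum>d\<in>{1..int m}. (\<Sum>a\<in>{0..<n}. G a ((a + d) mod n)) + (\<Sum>a\<in>{0..<n}. G a ((a + d) mod n)))"
proof -
  define S where "S d = (\<Sum>a\<in>{0..<n}. G a ((a + d) mod n))" for d
  have n: "n > 0" by (simp add: n_def)
  \<comment> \<open>Replacing \<open>a\<close> by \<open>a + d\<close> turns the pair
    \<open>(a, a - d)\<close> into \<open>(a + d, a)\<close>, the reversal of a pair of difference
    \<open>d\<close>.\<close>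
  have refl_S: "S (n - d) = S d" for d
  proof -
    have "G ((a + d) mod n) (((a + d) mod n + (n - d)) mod n) = G a ((a + d) mod n)"
      if "a \<in> {0..<n}" for a
    proof -
      have "((a + d) mod n + (n - d)) mod n = (a + n) mod n"
        unfolding mod_add_left_eq by simp
      also have "\<dots> = a" using that by simp
      finally show ?thesis by (simp add: sym)
    qed
    then show ?thesis
      unfolding S_def
      using sum.reindex_bij_betw[OF bij_betw_add_mod[OF n, of d],
          of "\<lambda>a. G a ((a + (n - d)) mod n)"]
      by simp
  qed
  have "{1..<n} = {1..int m} \<union> {int m + 1..<n}" by (auto simp: n_def)
  then have "(\<Sum>d\<in>{1..<n}. S d) = (\<Sum>d\<in>{1..int m}. S d) + (\<Sum>d\<in>{int m + 1..<n}. S d)"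
    by (simp only:) (rule sum.union_disjoint, auto)
  also have "(\<Sum>d\<in>{int m + 1..<n}. S d) = (\<Sum>d\<in>{1..int m}. S d)"
    by (rule sum.reindex_bij_witness[where i = "\<lambda>d. n - d" and j = "\<lambda>d. n - d"])
       (auto simp: n_def refl_S[unfolded n_def])
  finally show ?thesis
    unfolding sum_offdiag_int[OF n] S_def sum.distrib .
qed

text \<open>The model has \<open>y\<close> levels, each a copy of the \<open>k\<close>-element set
  \<open>C\<close>. Edges inside levels are covered by the Hamiltonian cycles, those between levels
  by the cyclic shifts with \<open>d \<le> m\<close>.\<close>

lemma cycle_factorizable_double_complete_mult:
  assumes "finite W" "card W = k * y" "even k" "k \<ge> 2" "odd y"
  shows "cycle_factorizable k W (double_complete W)"
proof -
  obtain h where h: "k = 2 * h" "h > 0" using assms(3,4) by (auto elim!: evenE)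
  obtain m where m: "y = 2 * m + 1" using assms(5) by (auto elim: oddE)
  define n where "n = 2 * int m + 1"
  define V where "V = {0..<n}"
  define C where "C = (UNIV :: bool set) \<times> {0..<int h}"
  have fin: "finite V" "finite C" by (simp_all add: V_def C_def)
  have cardC: "card C = k" by (simp add: C_def h card_cartesian_product)
  define G where "G v w = (\<Sum>p\<in>C. \<Sum>q\<in>C. {#{(v, p), (w, q)}#})" for v w :: int
  have sym: "G v w = G w v" for v w
    unfolding G_def by (subst sum.swap) (simp add: insert_commute)
  have shifts: "cycle_factorizable k (V \<times> C)
      ((\<Sum>v\<in>V. G v ((v + d) mod n)) + (\<Sum>v\<in>V. G v ((v + d) mod n)))" if d: "d \<in> {1..int m}" for d
  proof -
    have "(v + d) mod n \<noteq> v" if "v \<in> V" for v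
    proof
      assume "(v + d) mod n = v"
      then have "(v + d) mod n = v mod n" using that by (simp add: V_def)
      then have "n dvd d" by (simp add: mod_eq_dvd_iff)
      then show False using d zdvd_imp_le[of n d] by (simp add: n_def)
    qed
    then show ?thesis
      using cycle_factorizable_shift[OF fin(1), of "\<lambda>v. (v + d) mod n" h]
        bij_betw_add_mod[of n d] h
      by (simp add: V_def G_def C_def n_def)
  qed
  have "double_complete (V \<times> C) = (\<Sum>v\<in>V. image_mset (image (Pair v)) (double_complete C)) +
      (\<Sum>d\<in>{1..int m}. (\<Sum>v\<in>V. G v ((v + d) mod n)) + (\<Sum>v\<in>V. G v ((v + d) mod n)))"
    using double_complete_Times[OF fin] sum_offdiag_int_odd[of G m, OF sym]
    by (simp add: G_def[symmetric] V_def n_def)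
  also have "cycle_factorizable k (V \<times> C) \<dots>"
    by (intro cycle_factorizable_add cycle_factorizable_sum shifts cycle_factorizable_copies
        cycle_factorizable_double_complete fin cardC assms)
  finally have "cycle_factorizable k (V \<times> C) (double_complete (V \<times> C))" .
  then show ?thesis
  proof (rule cycle_factorizable_double_complete_transfer)
    have "card V = y" by (simp add: V_def n_def m)
    then show "card (V \<times> C) = card W" by (simp add: card_cartesian_product cardC assms(2))
  qed (use fin assms(1) in simp_all)
qed

section \<open>Idempotent Latin squares\<close>

text \<open>For finite \<open>V\<close>, closure and injectivity make all rows and columns
  permutations, so this is a Latin square.\<close>

definition idempotent_square :: "'a set \<Rightarrow> ('a \<Rightarrow> 'a \<Rightarrow> 'a) \<Rightarrow> bool" where
  "idempotent_square V s \<longleftrightarrow> (\<forall>i\<in>V. \<forall>v\<in>V. s i v \<in> V) \<and> (\<forall>i\<in>V. inj_on (s i) V) \<and>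
     (\<forall>v\<in>V. inj_on (\<lambda>i. s i v) V) \<and> (\<forall>i\<in>V. s i i = i)"

lemma idempotent_square_transfer:
  assumes "idempotent_square V s" "bij_betw f W V"
  shows "idempotent_square W (\<lambda>i v. inv_into W f (s (f i) (f v)))"
proof -
  have f: "f i \<in> V" "inv_into W f (f i) = i" if "i \<in> W" for i
    using that assms(2) by (auto simp: bij_betw_def)
  have f_eq: "f i = f j \<longleftrightarrow> i = j" if "i \<in> W" "j \<in> W" for i j
    using that assms(2) by (auto simp: bij_betw_def inj_on_eq_iff)
  have g: "inv_into W f a \<in> W" if "a \<in> V" for a
    using that assms(2) by (auto simp: bij_betw_def inv_into_into)
  have g_eq: "inv_into W f a = inv_into W f b \<longleftrightarrow> a = b" if "a \<in> V" "b \<in> V" for a b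
    using that assms(2) by (auto simp: bij_betw_def dest: inv_into_injective)
  have s: "s i v \<in> V" "s i i = i" if "i \<in> V" "v \<in> V" for i v
    using that assms(1) unfolding idempotent_square_def by auto
  have s_eq: "s i v = s i w \<longleftrightarrow> v = w" "s v i = s w i \<longleftrightarrow> v = w"
    if "i \<in> V" "v \<in> V" "w \<in> V" for i v w
    using that assms(1) unfolding idempotent_square_def by (auto dest: inj_onD)
  show ?thesis
    unfolding idempotent_square_def inj_on_def
    by (intro conjI ballI impI) (simp_all add: f f_eq g g_eq s s(2)[OF f(1) f(1)] s_eq)
qed

text \<open>For odd \<open>q\<close> the idempotent Latin square \<open>2 v - i\<close> over \<open>\<int>\<^sub>q\<close> has the transversal
  \<open>v = i + 1\<close>; moving it to a new row and column \<open>None\<close> gives even order \<open>q + 1\<close>.\<close>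

fun prolonged_square :: "int \<Rightarrow> int option \<Rightarrow> int option \<Rightarrow> int option" where
  "prolonged_square q None None = None"
| "prolonged_square q None (Some v) = Some ((v + 1) mod q)"
| "prolonged_square q (Some i) None = Some ((i + 2) mod q)"
| "prolonged_square q (Some i) (Some v) =
     (if v = (i + 1) mod q then None else Some ((2 * v - i) mod q))"

text \<open>Doubling is injective modulo the odd number \<open>q\<close>. Cell
  \<open>(i, i + 1)\<close> held \<open>i + 2\<close>; this symbol reappears in row \<open>i\<close>
  at column \<open>None\<close>, and in column \<open>i + 1\<close> at row \<open>None\<close>. As
  \<open>q \<ge> 3\<close>, the transversal misses the diagonal.\<close>

lemma idempotent_square_prolonged:
  fixes q :: int
  assumes "odd q" "q \<ge> 3"
  shows "idempotent_square (insert None (Some ` {0..<q})) (prolonged_square q)"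
proof -
  have eq: "a = b" if "q dvd a - b" "0 \<le> a" "a < q" "0 \<le> b" "b < q" for a b
    using that by (metis mod_eq_dvd_iff mod_pos_pos_trivial)
  have eq1: "v = (i + 1) mod q" if "q dvd v - (i + 1)" "0 \<le> v" "v < q" for v i
    using that by (metis mod_eq_dvd_iff mod_pos_pos_trivial)
  have half: "q dvd a" if "q dvd 2 * a" for a
    using that assms(1) by (simp add: coprime_dvd_mult_right_iff)
  have ne: "i \<noteq> (i + 1) mod q" if "0 \<le> i" "i < q" for i
  proof
    assume "i = (i + 1) mod q"
    then have "i mod q = (i + 1) mod q" using that by simp
    then have "q dvd 1" by (metis add_diff_cancel_left' mod_eq_dvd_iff)
    then show False using assms(2) by (simp add: zdvd1_eq)
  qed
  have add: "a = b" if "(a + c) mod q = (b + c) mod q" "0 \<le> a" "a < q" "0 \<le> b" "b < q" for a b c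
    using that by (intro eq) (simp_all add: mod_eq_dvd_iff)
  \<comment> \<open>\<open>row1\<close> and \<open>col1\<close> compare two old cells;
    \<open>row2\<close> and \<open>col2\<close> say that a moved symbol stood in its row or column
    only at the transversal cell.\<close>
  have row1: "v = w" if "(2 * v - i) mod q = (2 * w - i) mod q" "0 \<le> v" "v < q" "0 \<le> w" "w < q"
    for v w i
    using that eq[of v w] half[of "v - w"] by (simp add: mod_eq_dvd_iff algebra_simps)
  have row2: "v = (i + 1) mod q" if "(2 * v - i) mod q = (i + 2) mod q" "0 \<le> v" "v < q" for v i
    using that eq1[of v i] half[of "v - (i + 1)"] by (simp add: mod_eq_dvd_iff algebra_simps)
  have col1: "i = j" if "(2 * v - i) mod q = (2 * v - j) mod q" "0 \<le> i" "i < q" "0 \<le> j" "j < q"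
    for v i j
    using that eq[of j i] by (simp add: mod_eq_dvd_iff)
  have col2: "v = (i + 1) mod q" if "(2 * v - i) mod q = (v + 1) mod q" "0 \<le> v" "v < q" for v i
    using that by (intro eq1) (simp_all add: mod_eq_dvd_iff algebra_simps)
  define V where "V = insert None (Some ` {0..<q})"
  have V: "i \<in> V \<longleftrightarrow> (case i of None \<Rightarrow> True | Some a \<Rightarrow> 0 \<le> a \<and> a < q)" for i
    by (auto simp: V_def split: option.split)
  have row: "v = w" if "i \<in> V" "v \<in> V" "w \<in> V"
    and "prolonged_square q i v = prolonged_square q i w" for i v w
    using that
    by (cases i; cases v; cases w) (auto simp: V split: if_splits dest: add row1 row2 row2[OF sym])
  have col: "i = j" if "i \<in> V" "j \<in> V" "v \<in> V"
    and "prolonged_square q i v = prolonged_square q j v" for i j v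
    using that
    by (cases i; cases v; cases j) (auto simp: V split: if_splits dest: add col1 col2 col2[OF sym])
  have closed: "prolonged_square q i v \<in> V" if "i \<in> V" "v \<in> V" for i v
    using that assms(2) by (cases i; cases v) (auto simp: V)
  have idem: "prolonged_square q i i = i" if "i \<in> V" for i
    using that ne by (cases i) (auto simp: V)
  show ?thesis
    unfolding idempotent_square_def V_def[symmetric]
    by (intro conjI ballI inj_onI) (auto intro: closed idem row col)
qed

lemma ex_idempotent_square:
  assumes "finite W" "even (card W)" "card W \<ge> 4"
  shows "\<exists>s. idempotent_square W s"
proof -
  define q where "q = int (card W) - 1"
  define V where "V = insert None (Some ` {0..<q})"
  have "card V = card W" using assms by (simp add: V_def q_def card_image)
  then obtain f where "bij_betw f W V"
    using finite_same_card_bij[of W V] assms(1) by (auto simp: V_def)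
  moreover have "idempotent_square V (prolonged_square q)"
    unfolding V_def by (rule idempotent_square_prolonged) (use assms in \<open>auto simp: q_def\<close>)
  ultimately show ?thesis using idempotent_square_transfer by blast
qed

lemma bij_betw_idempotent_square:
  assumes s: "idempotent_square V s" and fin: "finite V" and i: "i \<in> V"
  shows "bij_betw (s i) (V - {i}) (V - {i})"
proof -
  have "inj_on (s i) V" "s i ` V \<subseteq> V" "s i i = i"
    using s i unfolding idempotent_square_def by auto
  then have "bij_betw (s i) V V" using fin by (simp add: bij_betw_def endo_inj_surj)
  from bij_betw_DiffI[OF this, of "{i}" "{i}"] show ?thesis
    using i \<open>s i i = i\<close> by (simp add: bij_betw_def)
qed

text \<open>Column \<open>v\<close> is injective, so \<open>i\<close> can be recovered from
  \<open>v\<close> and \<open>s i v\<close>. The image avoids the diagonal since the symbol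
  \<open>v\<close> stands in column \<open>v\<close> at row \<open>v\<close>.\<close>

lemma bij_betw_offdiag_idempotent_square:
  assumes s: "idempotent_square V s" and fin: "finite V"
  shows "bij_betw (\<lambda>(i, v). (v, s i v)) (offdiag V) (offdiag V)"
proof -
  have col: "i = j" if "s i v = s j v" "i \<in> V" "j \<in> V" "v \<in> V" for i j v
    using s that unfolding idempotent_square_def by (auto dest: inj_onD)
  have s_in: "s i v \<in> V" "s i i = i" if "i \<in> V" "v \<in> V" for i v
    using s that unfolding idempotent_square_def by auto
  have inj: "inj_on (\<lambda>(i, v). (v, s i v)) (offdiag V)"
    by (auto simp: inj_on_def offdiag_def intro: col)
  have "s i v \<noteq> v" if "i \<in> V" "v \<in> V" "i \<noteq> v" for i v
    using that col[of i v v] s_in(2)[of v v] by auto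
  then have "(\<lambda>(i, v). (v, s i v)) ` offdiag V \<subseteq> offdiag V"
    by (auto simp: offdiag_def s_in(1) dest: sym)
  then show ?thesis
    using inj fin by (simp add: bij_betw_def endo_inj_surj)
qed

section \<open>Lifting factors to the tensor product\<close>

text \<open>For finite \<open>V\<close> and \<open>a \<noteq> b\<close>, these are the edges of the
  tensor product of the complete graph on \<open>V\<close> with the single edge
  \<open>{a, b}\<close>.\<close>

definition lift_pair :: "'a set \<Rightarrow> 'b \<Rightarrow> 'b \<Rightarrow> ('a \<times> 'b) set multiset" where
  "lift_pair V a b = (\<Sum>(v, w) \<in> offdiag V. {#{(v, a), (w, b)}#})"

text \<open>The description is proper on unordered pairs because \<open>lift_pair\<close> is
  symmetric in \<open>a\<close> and \<open>b\<close>.\<close>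

definition lift_edge :: "'a set \<Rightarrow> 'b set \<Rightarrow> ('a \<times> 'b) set multiset" where
  "lift_edge V e = (THE X. \<exists>a b. e = {a, b} \<and> X = lift_pair V a b)"

lemma lift_pair_commute: "lift_pair V a b = lift_pair V b a"
  unfolding lift_pair_def
  by (rule sum.reindex_bij_witness[where i = prod.swap and j = prod.swap])
     (auto simp: offdiag_def insert_commute)

lemma lift_edge_doubleton: "lift_edge V {a, b} = lift_pair V a b"
  unfolding lift_edge_def by (rule the_equality) (auto simp: doubleton_eq_iff lift_pair_commute)

lemma sum_mset_sum_single: "(\<Sum>e \<in># (\<Sum>j\<in>J. {#x j#}). f e) = (\<Sum>j\<in>J. f (x j))"
  by (induction J rule: infinite_finite_induct) auto

text \<open>The list-based counterpart of \<open>partial_cycle_factor\<close>, before components are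
  considered.\<close>

definition holey_factor :: "nat \<Rightarrow> 'a set \<Rightarrow> 'b set \<Rightarrow> ('a \<times> 'b) multigraph \<Rightarrow> bool" where
  "holey_factor k V C F \<longleftrightarrow>
     (\<exists>i\<in>V. mverts F = (V - {i}) \<times> C) \<and> cycle_factor k (mverts F) (medges F)"

text \<open>For each hole \<open>i\<close> the factor is spread alternately along the permutation
  \<open>s i\<close> of \<open>V - {i}\<close>. Over all \<open>i\<close>, each cycle edge meets
  every ordered pair of distinct parts once and so contributes its full lift.\<close>

lemma ex_holey_factors_cycle_factor:
  assumes E: "cycle_factor k C E" and k: "even k"
    and s: "idempotent_square V s" and fin: "finite V" "finite C"
  shows "\<exists>Q. (\<forall>F \<in># Q. holey_factor k V C F) \<and> (\<Sum>F \<in># Q. medges F) = (\<Sum>e \<in># E. lift_edge V e)"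
proof -
  obtain M where M: "\<forall>vs \<in># M. length vs = k" "(\<Sum>vs \<in># M. mset vs) = mset_set C"
    "(\<Sum>vs \<in># M. cycle_edges vs) = E"
    using E unfolding cycle_factor_def by blast
  define F where "F i = \<lparr>mverts = (V - {i}) \<times> C,
    medges = (\<Sum>vs \<in># M. \<Sum>v\<in>V - {i}. cycle_edges (alternate v (s i v) vs))\<rparr>" for i
  have "holey_factor k V C (F i)" if "i \<in> V" for i
    unfolding holey_factor_def F_def
    using cycle_factor_alternate[OF M(1,2) bij_betw_idempotent_square[OF s fin(1) that]] fin that
    by auto
  moreover have "(\<Sum>i\<in>V. medges (F i)) = (\<Sum>e \<in># E. lift_edge V e)"
  proof -
    have cyc: "(\<Sum>i\<in>V. \<Sum>v\<in>V - {i}. cycle_edges (alternate v (s i v) vs)) =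
        (\<Sum>e \<in># cycle_edges vs. lift_edge V e)" if "vs \<in># M" for vs
    proof -
      have len: "even (length vs)" using M(1) k that by auto
      have off: "Sigma V (\<lambda>i. V - {i}) = offdiag V" by (auto simp: offdiag_def)
      have pair: "(\<Sum>(i, v) \<in> offdiag V. {#{(v, a), (s i v, b)}#}) = lift_pair V a b" for a b
        unfolding lift_pair_def
        using sum.reindex_bij_betw[OF bij_betw_offdiag_idempotent_square[OF s fin(1)],
            of "\<lambda>(v, w). {#{(v, a), (w, b)}#}"]
        by (simp add: case_prod_unfold)
      have "(\<Sum>i\<in>V. \<Sum>v\<in>V - {i}. cycle_edges (alternate v (s i v) vs)) =
          (\<Sum>(i, v) \<in> offdiag V. cycle_edges (alternate v (s i v) vs))"
        unfolding off[symmetric] by (rule sum.Sigma) (use fin in auto)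
      also have "\<dots> = (\<Sum>j<length vs. \<Sum>(i, v) \<in> offdiag V.
          if even j then {#{(v, vs ! j), (s i v, vs ! (Suc j mod length vs))}#}
          else {#{(v, vs ! (Suc j mod length vs)), (s i v, vs ! j)}#})"
        unfolding cycle_edges_alternate[OF len] case_prod_unfold by (rule sum.swap)
      \<comment> \<open>At odd positions the ends of the edge are exchanged, which
        \<open>lift_pair_commute\<close> absorbs.\<close>
      also have "\<dots> = (\<Sum>j<length vs. lift_edge V {vs ! j, vs ! (Suc j mod length vs)})"
      proof (rule sum.cong[OF refl])
        fix j
        show "(\<Sum>(i, v) \<in> offdiag V.
          if even j then {#{(v, vs ! j), (s i v, vs ! (Suc j mod length vs))}#}
          else {#{(v, vs ! (Suc j mod length vs)), (s i v, vs ! j)}#}) =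
          lift_edge V {vs ! j, vs ! (Suc j mod length vs)}"
          unfolding lift_edge_doubleton
          using pair[of "vs ! j" "vs ! (Suc j mod length vs)"]
            pair[of "vs ! (Suc j mod length vs)" "vs ! j"]
          by (cases "even j") (simp_all add: lift_pair_commute)
      qed
      also have "\<dots> = (\<Sum>e \<in># cycle_edges vs. lift_edge V e)"
        unfolding cycle_edges_eq_sum sum_mset_sum_single ..
      finally show ?thesis .
    qed
    have "(\<Sum>i\<in>V. medges (F i)) =
        (\<Sum>vs \<in># M. \<Sum>i\<in>V. \<Sum>v\<in>V - {i}. cycle_edges (alternate v (s i v) vs))"
      by (simp add: F_def sum_mset_sum[symmetric])
    also have "\<dots> = (\<Sum>vs \<in># M. \<Sum>e \<in># cycle_edges vs. lift_edge V e)"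
      by (intro arg_cong[where f = sum_mset] image_mset_cong cyc)
    also have "\<dots> = (\<Sum>e \<in># E. lift_edge V e)"
      unfolding M(3)[symmetric] by (induction M) auto
    finally show ?thesis .
  qed
  ultimately show ?thesis
    using fin by (intro exI[of _ "image_mset F (mset_set V)"]) (simp only: sum_mset_mset_set_image, auto)
qed

lemma ex_holey_factors:
  assumes "cycle_factorizable k C E" "even k" "idempotent_square V s" "finite V" "finite C"
  shows "\<exists>Q. (\<forall>F \<in># Q. holey_factor k V C F) \<and> (\<Sum>F \<in># Q. medges F) = (\<Sum>e \<in># E. lift_edge V e)"
proof -
  obtain P where P: "\<forall>F \<in># P. cycle_factor k C F" "E = \<Sum>\<^sub># P"
    using assms(1) unfolding cycle_factorizable_def by blast
  show ?thesis
    unfolding P(2) using P(1)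
  proof (induction P)
    case empty
    show ?case by (rule exI[of _ "{#}"]) simp
  next
    case (add F P)
    then obtain Q where Q: "\<forall>F \<in># Q. holey_factor k V C F"
      "(\<Sum>F \<in># Q. medges F) = (\<Sum>e \<in># \<Sum>\<^sub># P. lift_edge V e)" by auto
    have "cycle_factor k C F" using add.prems by simp
    from ex_holey_factors_cycle_factor[OF this assms(2-5)] obtain Q' where
      Q': "\<forall>F \<in># Q'. holey_factor k V C F" "(\<Sum>F \<in># Q'. medges F) = (\<Sum>e \<in># F. lift_edge V e)"
      by blast
    show ?case
      using Q Q' by (intro exI[of _ "Q' + Q"]) auto
  qed
qed

section \<open>The edge multiset of the doubled tensor product\<close>

text \<open>By symmetry and irreflexivity every edge has exactly two orientations in
  \<open>R\<close>; this accounts for the multiplicity 2.\<close>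

lemma sum_symmetric_relation:
  assumes fin: "finite R" and sym: "\<And>a b. (a, b) \<in> R \<Longrightarrow> (b, a) \<in> R"
    and irrefl: "\<And>a. (a, a) \<notin> R"
  shows "(\<Sum>(a, b) \<in> R. {#{a, b}#}) = repeat_mset 2 (mset_set ((\<lambda>(a, b). {a, b}) ` R))"
proof (rule multiset_eqI)
  fix e
  have "count (\<Sum>(a, b) \<in> R. {#{a, b}#}) e = (\<Sum>p\<in>R. if (case p of (a, b) \<Rightarrow> {a, b}) = e then 1 else 0)"
    unfolding count_sum case_prod_unfold count_single ..
  also have "\<dots> = card {p \<in> R. (case p of (a, b) \<Rightarrow> {a, b}) = e}"
    using fin by (simp add: sum.If_cases Int_def)
  also have "\<dots> = 2 * count (mset_set ((\<lambda>(a, b). {a, b}) ` R)) e"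
  proof (cases "e \<in> (\<lambda>(a, b). {a, b}) ` R")
    case True
    then obtain a b where ab: "(a, b) \<in> R" "e = {a, b}" by auto
    have "{p \<in> R. (case p of (a, b) \<Rightarrow> {a, b}) = e} = {(a, b), (b, a)}"
      using ab sym by (auto simp: doubleton_eq_iff)
    moreover have "a \<noteq> b" using ab irrefl by auto
    ultimately show ?thesis using True fin by simp
  next
    case False
    then have none: "{p \<in> R. (case p of (a, b) \<Rightarrow> {a, b}) = e} = {}" by auto
    show ?thesis unfolding none using False by simp
  qed
  finally show "count (\<Sum>(a, b) \<in> R. {#{a, b}#}) e =
      count (repeat_mset 2 (mset_set ((\<lambda>(a, b). {a, b}) ` R))) e" by simp
qed

text \<open>Sorting the oriented edges by their second coordinates yields one lift per ordered pair,
  which reduces the problem to the doubled complete graph on \<open>{1..g}\<close>.\<close>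

lemma medges_complete_tensor_2:
  "medges (complete_tensor u g 2) =
    (\<Sum>e \<in># double_complete {1..g}. lift_edge {1..u} e)"
proof -
  define R where "R = {((v, a), (w, b)). (v, w) \<in> offdiag {1..u} \<and> (a, b) \<in> offdiag {1..g}}"
  define f where "f = (\<lambda>((a :: nat, b :: nat), (v :: nat, w :: nat)). ((v, a), (w, b)))"
  have R: "R = f ` (offdiag {1..g} \<times> offdiag {1..u})"
    by (force simp: R_def f_def image_iff)
  have inj: "inj_on f (offdiag {1..g} \<times> offdiag {1..u})"
    by (auto simp: inj_on_def f_def)
  have edge: "{a, b} \<in> edges (complete_graph n) \<longleftrightarrow> (a, b) \<in> offdiag {1..n}" for a b n
    by (auto simp: complete_graph_def offdiag_def doubleton_eq_iff)
  have "edges (tensor_product (complete_graph u) (complete_graph g)) = (\<lambda>(a, b). {a, b}) ` R"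
    unfolding tensor_product_def by (force simp: edge R_def image_iff)
  moreover have "(\<Sum>(p, q) \<in> R. {#{p, q}#}) = repeat_mset 2 (mset_set ((\<lambda>(a, b). {a, b}) ` R))"
  proof (rule sum_symmetric_relation)
    show "finite R" by (simp add: R)
  qed (auto simp: R_def offdiag_def)
  ultimately have "medges (complete_tensor u g 2) = (\<Sum>(p, q) \<in> R. {#{p, q}#})"
    by (simp add: complete_tensor_def multiply_edges_def)
  also have "\<dots> = (\<Sum>(a, b) \<in> offdiag {1..g}. lift_pair {1..u} a b)"
    unfolding R sum.reindex[OF inj] sum.cartesian_product' lift_pair_def
    by (simp add: f_def case_prod_unfold)
  also have "\<dots> = (\<Sum>e \<in># double_complete {1..g}. lift_edge {1..u} e)"
    unfolding double_complete_def case_prod_unfold sum_mset_sum_single lift_edge_doubleton ..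
  finally show ?thesis .
qed

section \<open>Components of a union of cycles\<close>

text \<open>Nonemptiness will ensure that an edge of a disjoint list is not a subset of
  \<open>set vs\<close>.\<close>

lemma cycle_edges_subset: "e \<in># cycle_edges vs \<Longrightarrow> e \<subseteq> set vs \<and> e \<noteq> {}"
  by (auto simp: cycle_edges_def) (metis gr_implies_not0 mod_less_divisor neq0_conv nth_mem)

text \<open>No edge leaves its list and the lists are disjoint, so the component of \<open>v\<close>
  is spanned by the list through \<open>v\<close> and has only the edges of that list.\<close>

lemma components_cycle_factor:
  assumes F: "cycle_factor k (mverts F) (medges F)" and fin: "finite (mverts F)"
    and C: "C \<in> components F"
  shows "is_cycle k C"
proof -
  obtain M where M: "\<forall>vs \<in># M. length vs = k" "(\<Sum>vs \<in># M. mset vs) = mset_set (mverts F)"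
    "(\<Sum>vs \<in># M. cycle_edges vs) = medges F"
    using F unfolding cycle_factor_def by blast
  obtain v where v: "v \<in> mverts F" "C = induced_subgraph F {w. (adjacent F)\<^sup>*\<^sup>* v w}"
    using C unfolding components_def by blast
  have "v \<in># (\<Sum>vs \<in># M. mset vs)" using v(1) fin M(2) by simp
  then obtain vs where vs: "vs \<in># M" "v \<in> set vs" by auto
  obtain N where N: "M = add_mset vs N" using vs(1) by (metis insert_DiffM)
  \<comment> \<open>Multiplicities in \<open>mset_set\<close> are at most one; this gives both the
    distinctness of \<open>vs\<close> and its disjointness from the other lists.\<close>
  have le1: "count (mset vs + (\<Sum>ws \<in># N. mset ws)) a \<le> 1" for a
    using M(2) N by (simp add: count_mset_set')
  have "count (mset vs) a \<le> 1" for a using le1[of a] by simp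
  then have dist: "distinct vs"
    by (metis distinct_count_atmost_1 count_mset_0_iff le_antisym le_zero_eq not_less_eq_eq One_nat_def)
  have disj: "set vs \<inter> set ws = {}" if "ws \<in># N" for ws
  proof -
    have False if "a \<in> set vs" "a \<in> set ws" for a
    proof -
      have "a \<in># (\<Sum>ws \<in># N. mset ws)" using that \<open>ws \<in># N\<close> by auto
      then have "count (\<Sum>ws \<in># N. mset ws) a \<ge> 1" by (simp add: count_greater_eq_one_iff del: in_Union_mset_iff)
      moreover have "count (mset vs) a \<ge> 1" using that by (simp add: Suc_le_eq)
      ultimately show False using le1[of a] unfolding count_union by linarith
    qed
    then show ?thesis by blast
  qed
  have len: "length vs = k" using M(1) vs by simp
  have sub: "set vs \<subseteq> mverts F"
  proof
    fix a assume "a \<in> set vs"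
    then have "a \<in># (\<Sum>vs \<in># M. mset vs)" using vs(1) by auto
    then show "a \<in> mverts F" using M(2) fin by simp
  qed
  have step: "b \<in> set vs" if a: "a \<in> set vs" and ab: "adjacent F a b" for a b
  proof -
    obtain ws where ws: "ws \<in># M" "{a, b} \<in># cycle_edges ws"
      using ab M(3)[symmetric] unfolding adjacent_def by auto
    then have "a \<in> set ws" "b \<in> set ws" using cycle_edges_subset by blast+
    then show ?thesis using ws(1) N disj a by auto
  qed
  have closed: "w \<in> set vs" if "(adjacent F)\<^sup>*\<^sup>* v w" for w
    using that by induction (use vs(2) step in auto)
  obtain i where i: "i < k" "v = vs ! i" using vs(2) len by (auto simp: in_set_conv_nth)
  have adj: "adjacent F (vs ! j) (vs ! (Suc j mod k))" if "j < k" for j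
  proof -
    have "{vs ! j, vs ! (Suc j mod k)} \<in># cycle_edges vs"
      using that len by (auto simp: cycle_edges_def)
    then show ?thesis unfolding adjacent_def M(3)[symmetric] using vs(1) by auto
  qed
  have "(adjacent F)\<^sup>*\<^sup>* v (vs ! ((i + n) mod k))" for n
  proof (induction n)
    case (Suc n)
    have "adjacent F (vs ! ((i + n) mod k)) (vs ! (Suc (i + n) mod k))"
      using adj[of "(i + n) mod k"] i(1) by (simp add: mod_Suc_eq)
    then show ?case using Suc by simp
  qed (use i in simp)
  \<comment> \<open>Walking forward from index \<open>i\<close>, \<open>k - i + j\<close> steps end
    at \<open>j\<close>; the detour by \<open>k\<close> avoids the truncated difference
    \<open>j - i\<close>.\<close>
  moreover have "j = (i + (k - i + j)) mod k" if "j < k" for j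
    using that i(1) by simp
  ultimately have reach: "(adjacent F)\<^sup>*\<^sup>* v w" if "w \<in> set vs" for w
    using that len by (metis in_set_conv_nth)
  have comp: "{w. (adjacent F)\<^sup>*\<^sup>* v w} = set vs" using closed reach by auto
  have "filter_mset (\<lambda>e. e \<subseteq> set vs) (\<Sum>ws \<in># N. cycle_edges ws) = {#}"
    unfolding filter_mset_eq_mempty_iff using disj cycle_edges_subset by fastforce
  moreover have "filter_mset (\<lambda>e. e \<subseteq> set vs) (cycle_edges vs) = cycle_edges vs"
    unfolding filter_mset_eq_conv using cycle_edges_subset by fastforce
  ultimately have "filter_mset (\<lambda>e. e \<subseteq> set vs) (medges F) = cycle_edges vs"
    unfolding M(3)[symmetric] N by simp
  then show ?thesis
    unfolding is_cycle_def v(2) comp induced_subgraph_def using dist len sub by (intro exI[of _ vs]) auto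
qed

section \<open>From holey factors to the ARCS\<close>

text \<open>Edges of \<open>F\<close> have both ends outside the part \<open>i\<close>, so deleting
  that part from the tensor product removes none of them.\<close>

lemma partial_cycle_factorI:
  assumes F: "holey_factor k {1..u} {1..g} F" and sub: "medges F \<subseteq># medges (complete_tensor u g l)"
  shows "partial_cycle_factor k u g l F"
proof -
  obtain i where i: "i \<in> {1..u}" "mverts F = ({1..u} - {i}) \<times> {1..g}"
    and cf: "cycle_factor k (mverts F) (medges F)"
    using F unfolding holey_factor_def by blast
  have fin: "finite (mverts F)" using i by simp
  have edge: "e \<subseteq> mverts F" if e: "e \<in># medges F" for e
  proof -
    obtain M where M: "(\<Sum>vs \<in># M. mset vs) = mset_set (mverts F)"
      "(\<Sum>vs \<in># M. cycle_edges vs) = medges F"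
      using cf unfolding cycle_factor_def by blast
    obtain vs where vs: "vs \<in># M" "e \<in># cycle_edges vs" using e M(2)[symmetric] by auto
    have "a \<in> mverts F" if "a \<in> e" for a
    proof -
      have "a \<in># (\<Sum>vs \<in># M. mset vs)" using that vs cycle_edges_subset by auto
      then show ?thesis using M(1) fin by simp
    qed
    then show ?thesis by blast
  qed
  have part: "partite_set g i = {i} \<times> {1..g}" by (simp add: partite_set_def complete_graph_def)
  have "filter_mset (\<lambda>e. e \<inter> partite_set g i = {}) (medges F) = medges F"
    unfolding filter_mset_eq_conv using edge i(2) part by fastforce
  then have "medges F \<subseteq># filter_mset (\<lambda>e. e \<inter> partite_set g i = {}) (medges (complete_tensor u g l))"
    using multiset_filter_mono[OF sub] by metis
  moreover have "mverts F = mverts (complete_tensor u g l) - partite_set g i"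
    unfolding i(2) part
    by (auto simp: complete_tensor_def multiply_edges_def tensor_product_def complete_graph_def)
  ultimately have "spanning_subgraph F (delete_verts (complete_tensor u g l) (partite_set g i))"
    using edge unfolding spanning_subgraph_def subgraph_def delete_verts_def by simp
  then show ?thesis
    unfolding partial_cycle_factor_def using i(1) components_cycle_factor[OF cf fin] by blast
qed

theorem theorem4p4:
  fixes k x y u g :: nat
  assumes "k \<ge> 6" and "even k"
    and "y \<ge> 1" and "odd y"
    and "x > 0" and "x \<noteq> 2"
    and "u = 4 * x" and "g = k * y"
  shows "\<exists>P. is_ARCS k u g 2 P"
proof -
  obtain s where s: "idempotent_square {1..u} s"
    using ex_idempotent_square[of "{1..u}"] assms by auto
  have "cycle_factorizable k {1..g} (double_complete {1..g})"
    by (rule cycle_factorizable_double_complete_mult) (use assms in auto)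
  from ex_holey_factors[OF this \<open>even k\<close> s] obtain Q where
    Q: "\<forall>F \<in># Q. holey_factor k {1..u} {1..g} F"
      "(\<Sum>F \<in># Q. medges F) = medges (complete_tensor u g 2)"
    unfolding medges_complete_tensor_2 by auto
  \<comment> \<open>The edge multisets of the members of \<open>Q\<close> add up to the whole, so
    each is contained in it, as \<open>partial_cycle_factorI\<close> requires.\<close>
  have "medges F \<subseteq># medges (complete_tensor u g 2)" if "F \<in># Q" for F
    using that unfolding Q(2)[symmetric] by (metis insert_DiffM image_mset_add_mset
        sum_mset.insert mset_subset_eq_add_left)
  then have "is_ARCS k u g 2 Q"
    unfolding is_ARCS_def using Q partial_cycle_factorI by blast
  then show ?thesis ..
qed

end
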